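(* Consider the control system $$\dot{x}=f(x)+g(x)u+g(x)(\varphi(x))'\theta ,$$ where $f,g:\mathbb{R}^n\to\mathbb{R}^n$ and $\varphi:\mathbb{R}^n\to\mathbb{R}^p$ are locally Lipschitz with $f(0)=0$ and $\varphi(0)=0$, $x\in\mathbb{R}^n$ is the state, $u\in\mathbb{R}$ is the control input and $\theta\in\mathbb{R}^p$ is a constant vector (of unknown parameters). Suppose that: (1) there exist positive definite and radially unbounded functions $P\in C^2(\mathbb{R}^n;\mathbb{R}_+)$, $Q\in C^0(\mathbb{R}^n;\mathbb{R}_+)$ and a locally Lipschitz function $k:\mathbb{R}^n\to\mathbb{R}$ with $k(0)=0$ such that $$\nabla P(x)f(x)+\nabla P(x)g(x)k(x)\leq -Q(x)\quad\text{for all }x\in\mathbb{R}^n;$$ (2) there exists a locally Lipschitz function $\mu:\mathbb{R}^n\to(0,+\infty)$ such that $$|\varphi(x)|^2\leq \mu(x)Q(x)\quad\text{for all }x\in\mathbb{R}^n.$$ Let $\Gamma\in\mathbb{R}^{p\times p}$ be a positive definite matrix, let $\delta>0$ and $r\geq 0$ be constants, and consider the adaptive controller $$u=k(x)-(\varphi(x))'\hat\theta-\left(\frac{\delta}{2}|\varphi(x)|^2+\mu(x)\left(r+|\hat\theta|^2\right)\right)\nabla P(x)g(x),\qquad \frac{d\hat\theta}{dt}=\Gamma\,\nabla P(x)g(x)\,\varphi(x).$$ Let $\rho\in K_\infty$ be a function for which $$\rho(P(x))\leq Q(x)\quad\text{for all }x\in\mathbb{R}^n .$$ Then for every $\lambda\in(0,1)$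 there exists $\sigma\in KL$ such that the following estimate holds for every solution $(x(t),\hat\theta(t))$ of the closed-loop system consisting of the control system $\dot{x}=f(x)+g(x)u+g(x)(\varphi(x))'\theta$ together with the adaptive controller $u=k(x)-(\varphi(x))'\hat\theta-\left(\frac{\delta}{2}|\varphi(x)|^2+\mu(x)\left(r+|\hat\theta|^2\right)\right)\nabla P(x)g(x)$, $\frac{d\hat\theta}{dt}=\Gamma\,\nabla P(x)g(x)\,\varphi(x)$: $$\left(P(x(t))-\alpha\right)^+\leq\sigma\left(\left(P(x(0))-\alpha\right)^+,t\right)\quad\text{for all }t\geq 0,$$ where $$\alpha:=\rho^{-1}\left((1-\lambda)^{-1}\delta^{-1}\left(|\theta|^2-r\right)^+\right).$$
   Context: For $s\in\mathbb{R}$, $(s)^+:=\max(s,0)$. For a vector $x$, $|x|$ is the Euclidean norm and $x'$ the transpose; $\mathbb{R}_+=[0,+\infty)$. $\nabla P(x)$ is the gradient of $P$ written as a row vector, so $\nabla P(x)g(x)\in\mathbb{R}$. A function $P:\mathbb{R}^n\to\mathbb{R}_+$ is positive definite if $P(0)=0$ and $P(x)>0$ for $x\ne0$, and radially unbounded if $P(x)\to+\infty$ as $|x|\to+\infty$. $K_\infty$ is the class of continuous, strictly increasing, unbounded functions $\rho:\mathbb{R}_+\to\mathbb{R}_+$ with $\rho(0)=0$. $KL$ is the class of continuous functions $\sigma:\mathbb{R}_+\times\mathbb{R}_+\to\mathbb{R}_+$ such that, for each $t\ge0$, $\sigma(\cdot,t)$ is strictly increasing with $\sigma(0,t)=0$,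 and, for each $s\geq0$, $\sigma(s,\cdot)$ is non-increasing with $\lim_{t\to+\infty}\sigma(s,t)=0$. The state of the closed-loop system is $(x,\hat\theta)\in\mathbb{R}^n\times\mathbb{R}^p$. *)

theory Defs
  imports "HOL-Analysis.Analysis"
begin

definition locally_lipschitz :: "('a::metric_space \<Rightarrow> 'b::metric_space) \<Rightarrow> bool" where
  "locally_lipschitz f \<longleftrightarrow> (\<forall>x. \<exists>u>0. \<exists>L. L-lipschitz_on (cball x u) f)"

definition positive_definite_fun :: "('a::real_normed_vector \<Rightarrow> real) \<Rightarrow> bool" where
  "positive_definite_fun P \<longleftrightarrow> P 0 = 0 \<and> (\<forall>x. x \<noteq> 0 \<longrightarrow> P x > 0)"

definition radially_unbounded :: "('a::real_normed_vector \<Rightarrow> real) \<Rightarrow> bool" where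
  "radially_unbounded P \<longleftrightarrow> filterlim P at_top at_infinity"

(* Symmetry is not required, so symmetric positive definite matrices are a special case. *)
definition positive_definite_matrix :: "real ^ 'p ^ 'p \<Rightarrow> bool" where
  "positive_definite_matrix A \<longleftrightarrow> (\<forall>v. v \<noteq> 0 \<longrightarrow> v \<bullet> (A *v v) > 0)"

definition gradient :: "('a::real_inner \<Rightarrow> real) \<Rightarrow> 'a \<Rightarrow> 'a" where
  "gradient P x = (THE D. GDERIV P x :> D)"

(* H is the Hessian matrix of P, i.e. the Jacobian matrix of the gradient. *)
definition C2_fun :: "(real ^ 'n \<Rightarrow> real) \<Rightarrow> bool" where
  "C2_fun P \<longleftrightarrow>
     (\<forall>x. P differentiable (at x)) \<and>
     (\<exists>H :: real ^ 'n \<Rightarrow> real ^ 'n ^ 'n.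
        (\<forall>x. (gradient P has_derivative (\<lambda>v. H x *v v)) (at x)) \<and>
        continuous_on UNIV H)"

(* Comparison functions live on [0,\<infinity>); their values at negative arguments are irrelevant. *)
definition class_K_inf :: "(real \<Rightarrow> real) \<Rightarrow> bool" where
  "class_K_inf \<rho> \<longleftrightarrow>
     continuous_on {0..} \<rho> \<and> strict_mono_on {0..} \<rho> \<and>
     (\<forall>M. \<exists>s\<ge>0. \<rho> s > M) \<and> \<rho> 0 = 0"

definition inverse_on_nonneg :: "(real \<Rightarrow> real) \<Rightarrow> real \<Rightarrow> real" where
  "inverse_on_nonneg \<rho> = inv_into {0..} \<rho>"

definition class_KL :: "(real \<Rightarrow> real \<Rightarrow> real) \<Rightarrow> bool" where
  "class_KL \<sigma> \<longleftrightarrow>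
     continuous_on ({0..} \<times> {0..}) (\<lambda>(s, t). \<sigma> s t) \<and>
     (\<forall>s\<ge>0. \<forall>t\<ge>0. \<sigma> s t \<ge> 0) \<and>
     (\<forall>t\<ge>0. strict_mono_on {0..} (\<lambda>s. \<sigma> s t) \<and> \<sigma> 0 t = 0) \<and>
     (\<forall>s\<ge>0. antimono_on {0..} (\<sigma> s) \<and> (\<sigma> s \<longlongrightarrow> 0) at_top)"

definition time_interval :: "ereal \<Rightarrow> real set" where
  "time_interval T = {t. 0 \<le> t \<and> ereal t < T}"

(* z is a solution of z' = F z on [0,T), where T may be \<infinity>; the derivative at t = 0 is one-sided. *)
definition is_solution :: "('a::real_normed_vector \<Rightarrow> 'a) \<Rightarrow> ereal \<Rightarrow> (real \<Rightarrow> 'a) \<Rightarrow> bool" where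
  "is_solution F T z \<longleftrightarrow>
     T > 0 \<and>
     (\<forall>t\<in>time_interval T. (z has_vector_derivative F (z t)) (at t within time_interval T))"

definition is_maximal_solution ::
    "('a::real_normed_vector \<Rightarrow> 'a) \<Rightarrow> ereal \<Rightarrow> (real \<Rightarrow> 'a) \<Rightarrow> bool" where
  "is_maximal_solution F T z \<longleftrightarrow>
     is_solution F T z \<and>
     \<not> (\<exists>T' z'. T < T' \<and> is_solution F T' z' \<and> (\<forall>t\<in>time_interval T. z' t = z t))"

definition plant ::
    "(real ^ 'n \<Rightarrow> real ^ 'n) \<Rightarrow> (real ^ 'n \<Rightarrow> real ^ 'n) \<Rightarrow> (real ^ 'n \<Rightarrow> real ^ 'p)
      \<Rightarrow> real ^ 'p \<Rightarrow> real ^ 'n \<Rightarrow> real \<Rightarrow> real ^ 'n" where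
  "plant f g \<phi> \<theta> x u = f x + u *\<^sub>R g x + (\<phi> x \<bullet> \<theta>) *\<^sub>R g x"

definition control_law ::
    "(real ^ 'n \<Rightarrow> real ^ 'n) \<Rightarrow> (real ^ 'n \<Rightarrow> real ^ 'p) \<Rightarrow> (real ^ 'n \<Rightarrow> real)
      \<Rightarrow> (real ^ 'n \<Rightarrow> real) \<Rightarrow> (real ^ 'n \<Rightarrow> real) \<Rightarrow> real \<Rightarrow> real
      \<Rightarrow> real ^ 'n \<Rightarrow> real ^ 'p \<Rightarrow> real" where
  "control_law g \<phi> P k \<mu> \<delta> r x \<theta>h =
     k x - \<phi> x \<bullet> \<theta>h
       - (\<delta> / 2 * (norm (\<phi> x))\<^sup>2 + \<mu> x * (r + (norm \<theta>h)\<^sup>2)) * (gradient P x \<bullet> g x)"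

definition update_law ::
    "(real ^ 'n \<Rightarrow> real ^ 'n) \<Rightarrow> (real ^ 'n \<Rightarrow> real ^ 'p) \<Rightarrow> (real ^ 'n \<Rightarrow> real)
      \<Rightarrow> real ^ 'p ^ 'p \<Rightarrow> real ^ 'n \<Rightarrow> real ^ 'p" where
  "update_law g \<phi> P \<Gamma> x = \<Gamma> *v ((gradient P x \<bullet> g x) *\<^sub>R \<phi> x)"

definition closed_loop ::
    "(real ^ 'n \<Rightarrow> real ^ 'n) \<Rightarrow> (real ^ 'n \<Rightarrow> real ^ 'n) \<Rightarrow> (real ^ 'n \<Rightarrow> real ^ 'p)
      \<Rightarrow> real ^ 'p \<Rightarrow> (real ^ 'n \<Rightarrow> real) \<Rightarrow> (real ^ 'n \<Rightarrow> real) \<Rightarrow> (real ^ 'n \<Rightarrow> real)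
      \<Rightarrow> real ^ 'p ^ 'p \<Rightarrow> real \<Rightarrow> real
      \<Rightarrow> (real ^ 'n) \<times> (real ^ 'p) \<Rightarrow> (real ^ 'n) \<times> (real ^ 'p)" where
  "closed_loop f g \<phi> \<theta> P k \<mu> \<Gamma> \<delta> r =
     (\<lambda>(x, \<theta>h). (plant f g \<phi> \<theta> x (control_law g \<phi> P k \<mu> \<delta> r x \<theta>h), update_law g \<phi> P \<Gamma> x))"

end

theory Submission
  imports Defs
begin

text \<open>
  Along the closed loop, with \<open>x\<close> the state and \<open>\<eta>\<close> the parameter estimate, put
  \<open>w = \<nabla>P(x) g(x)\<close>. The derivative of \<open>P\<close> is at most
  \<open>- Q + w \<phi>'\<theta> - w \<phi>'\<eta> - (\<delta>/2 |\<phi>|\<^sup>2 + \<mu> (r + |\<eta>|\<^sup>2)) w\<^sup>2\<close>. The indefinite terms are absorbed by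
  Young's inequality: the damping \<open>\<mu> |\<eta>|\<^sup>2 w\<^sup>2\<close> takes care of \<open>w \<phi>'\<eta>\<close> and \<open>\<mu> r w\<^sup>2\<close> of the part of
  \<open>w \<phi>'\<theta>\<close> with \<open>|\<theta>|\<^sup>2 \<le> r\<close>, each at the price of \<open>Q/4\<close> because \<open>|\<phi>|\<^sup>2 \<le> \<mu> Q\<close>; the damping
  \<open>\<delta>/2 |\<phi>|\<^sup>2 w\<^sup>2\<close> takes care of the excess \<open>e = (|\<theta>|\<^sup>2 - r)\<^sup>+\<close> at the price of \<open>e/(2\<delta>)\<close>
  (\<open>dissipation_inequality\<close>). Hence \<open>P\<close> has derivative at most \<open>- Q/2 + e/(2\<delta>)\<close>, whatever \<open>\<eta>\<close>
  is. Where \<open>P > \<alpha>\<close>, the choice of \<open>\<alpha>\<close> bounds \<open>e/(2\<delta>)\<close> by \<open>(1 - \<lambda>) \<rho>(P)/2\<close>, which leaves the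
  decay rate \<open>- (\<lambda>/2) \<rho>(P)\<close>.

  To turn this decay into a KL estimate no comparison equation has to be solved. While
  \<open>v = (P - \<alpha>)\<^sup>+\<close> is positive it decreases, so up to time \<open>t\<close> its slope is at most \<open>- c \<rho>(v(t))\<close>
  with \<open>c = \<lambda>/2\<close>, and the mean value theorem gives \<open>v(t) + c t \<rho>(v(t)) \<le> v(0)\<close>
  (\<open>decay_above_threshold\<close>). Inverting \<open>v \<mapsto> v + c t \<rho>(v)\<close> for each \<open>t\<close> yields a function of class KL
  (\<open>ex_class_KL_dominating\<close>), which depends on \<open>\<lambda>\<close> and \<open>\<rho>\<close> only.

  For global existence, suppose that a maximal solution lives on a bounded time interval. The
  estimate keeps \<open>P(x(t))\<close> bounded, so \<open>x\<close> stays in a bounded set. The update law depends on \<open>x\<close>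
  alone, so the estimate \<open>\<eta>\<close> has bounded speed and stays bounded in finite time. But a bounded
  solution of a locally Lipschitz equation has a limit at the end of its interval, from where
  Picard's theorem continues it (\<open>bounded_solution_not_maximal\<close>).
\<close>

section \<open>A comparison function of class KL\<close>

lemma class_K_inf_nonneg:
  assumes "class_K_inf \<rho>" "0 \<le> v"
  shows "0 \<le> \<rho> v"
  using strict_mono_on_leD[of "{0..}" \<rho> 0 v] assms by (simp add: class_K_inf_def)

lemma class_K_inf_surj:
  assumes "class_K_inf \<rho>" "0 \<le> b"
  shows "b \<in> \<rho> ` {0..}"
proof -
  obtain s where s: "0 \<le> s" "b < \<rho> s"
    using assms unfolding class_K_inf_def by blast
  have "\<exists>v. 0 \<le> v \<and> v \<le> s \<and> \<rho> v = b"
    by (rule IVT')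
      (use assms s in \<open>auto simp: class_K_inf_def intro: continuous_on_subset\<close>)
  then show ?thesis by auto
qed

text \<open>
  The usual route from a differential inequality \<open>v' \<le> - c \<rho>(v)\<close> to a KL bound solves the
  comparison equation. The weaker algebraic consequence \<open>v + c t \<rho>(v) \<le> s\<close>, where \<open>s\<close> is the
  initial value, is enough: for fixed \<open>t\<close> its left side is a homeomorphism \<open>K t\<close> of the half
  line, and \<open>\<sigma> s t = (K t)\<^sup>-\<^sup>1 s\<close> works. The limit of \<open>\<sigma> s t\<close> as \<open>t \<rightarrow> \<infinity>\<close> is \<open>0\<close> because \<open>K t a\<close>
  exceeds any \<open>s\<close> for \<open>a > 0\<close> and large \<open>t\<close>.
\<close>
lemma ex_class_KL_dominating:
  assumes \<rho>: "class_K_inf \<rho>" and c: "0 < c"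
  shows "\<exists>\<sigma>. class_KL \<sigma> \<and>
    (\<forall>s t v. 0 \<le> v \<longrightarrow> 0 \<le> t \<longrightarrow> v + c * t * \<rho> v \<le> s \<longrightarrow> v \<le> \<sigma> s t)"
proof -
  define K where "K t v = v + c * t * \<rho> v" for t v
  have \<rho>_cont: "continuous_on {0..} \<rho>" and \<rho>_mono: "strict_mono_on {0..} \<rho>" and \<rho>0: "\<rho> 0 = 0"
    using \<rho> by (auto simp: class_K_inf_def)
  note \<rho>_nonneg = class_K_inf_nonneg[OF \<rho>]
  have K_mono: "K t a < K t b" if "0 \<le> t" "0 \<le> a" "a < b" for t a b
  proof -
    have "\<rho> a < \<rho> b" using \<rho>_mono that by (auto simp: strict_mono_on_def)
    then have "c * t * \<rho> a \<le> c * t * \<rho> b" using c that by (intro mult_left_mono) auto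
    then show ?thesis using that by (simp add: K_def)
  qed
  have K_ex: "\<exists>v. 0 \<le> v \<and> K t v = s" if "0 \<le> t" "0 \<le> s" for s t
  proof -
    have "\<exists>v. 0 \<le> v \<and> v \<le> s \<and> K t v = s"
    proof (rule IVT')
      show "K t 0 \<le> s" using that by (simp add: K_def \<rho>0)
      show "s \<le> K t s" using that c \<rho>_nonneg[of s] by (simp add: K_def)
      show "continuous_on {0..s} (K t)"
        unfolding K_def by (intro continuous_intros continuous_on_subset[OF \<rho>_cont]) auto
    qed (use that in auto)
    then show ?thesis by blast
  qed
  define \<sigma> where "\<sigma> s t = (SOME v. 0 \<le> v \<and> K t v = s)" for s t
  have \<sigma>: "0 \<le> \<sigma> s t" "K t (\<sigma> s t) = s" if "0 \<le> t" "0 \<le> s" for s t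
    using someI_ex[OF K_ex[OF that]] by (auto simp: \<sigma>_def)
  \<comment> \<open>Everything below is read off from these two equivalences, which trade \<open>\<sigma>\<close> for the
      explicit function \<open>K\<close>.\<close>
  have less_\<sigma>: "a < \<sigma> s t \<longleftrightarrow> K t a < s" if "0 \<le> t" "0 \<le> s" "0 \<le> a" for a s t
    using \<sigma>[OF that(1,2)] K_mono[OF that(1), of a "\<sigma> s t"] K_mono[OF that(1), of "\<sigma> s t" a] that
    by (metis linorder_less_linear order_less_asym)
  have \<sigma>_less: "\<sigma> s t < a \<longleftrightarrow> s < K t a" if "0 \<le> t" "0 \<le> s" "0 \<le> a" for a s t
    using \<sigma>[OF that(1,2)] K_mono[OF that(1), of a "\<sigma> s t"] K_mono[OF that(1), of "\<sigma> s t" a] that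
    by (metis linorder_less_linear order_less_asym)
  have K_lim: "((\<lambda>p. K (snd p) a) \<longlongrightarrow> K t a) (at (s, t) within {0..} \<times> {0..})" for a s t :: real
    unfolding K_def by (auto intro!: tendsto_eq_intros)
  have fst_lim: "(fst \<longlongrightarrow> s) (at (s, t) within {0..} \<times> {0..})" for s t :: real
    by (auto intro!: tendsto_eq_intros)
  have "continuous_on ({0..} \<times> {0..}) (\<lambda>(s, t). \<sigma> s t)"
    unfolding continuous_on_def
  proof (clarsimp, rule order_tendstoI)
    fix s t a :: real assume st: "0 \<le> s" "0 \<le> t"
    let ?F = "at (s, t) within {0..} \<times> {0..}"
    have dom: "\<forall>\<^sub>F p in ?F. p \<in> {0..} \<times> {0..}" by (simp add: eventually_at_filter)
    show "\<forall>\<^sub>F p in ?F. a < (case p of (s, t) \<Rightarrow> \<sigma> s t)" if "a < \<sigma> s t"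
    proof (cases "0 \<le> a")
      case True
      then have "K t a < s" using less_\<sigma> st that by simp
      then have "\<forall>\<^sub>F p in ?F. 0 < fst p - K (snd p) a"
        by (intro order_tendstoD[OF tendsto_diff[OF fst_lim K_lim]]) simp
      with dom show ?thesis
        by eventually_elim (use less_\<sigma> True in auto)
    next
      case False
      from dom show ?thesis
        by eventually_elim (use \<sigma> False in \<open>force simp: not_le intro: less_le_trans\<close>)
    qed
    show "\<forall>\<^sub>F p in ?F. (case p of (s, t) \<Rightarrow> \<sigma> s t) < a" if "\<sigma> s t < a"
    proof -
      have a: "0 \<le> a" using \<sigma>(1)[of t s] st that by simp
      then have "s < K t a" using \<sigma>_less st that by simp
      then have "\<forall>\<^sub>F p in ?F. fst p - K (snd p) a < 0"
        by (intro order_tendstoD[OF tendsto_diff[OF fst_lim K_lim]]) simp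
      with dom show ?thesis
        by eventually_elim (use \<sigma>_less a in auto)
    qed
  qed
  moreover have "strict_mono_on {0..} (\<lambda>s. \<sigma> s t)" if "0 \<le> t" for t
  proof (rule strict_mono_onI)
    fix s s' :: real assume "s \<in> {0..}" "s' \<in> {0..}" "s < s'"
    then show "\<sigma> s t < \<sigma> s' t" using less_\<sigma>[of t s' "\<sigma> s t"] \<sigma>[of t s] that by auto
  qed
  moreover have "\<sigma> 0 t = 0" if "0 \<le> t" for t
    using less_\<sigma>[of t 0 0] \<sigma>(1)[of t 0] that by (simp add: K_def \<rho>0)
  moreover have "antimono_on {0..} (\<sigma> s)" if "0 \<le> s" for s
  proof (rule monotone_onI)
    fix t t' :: real assume t: "t \<in> {0..}" "t' \<in> {0..}" "t \<le> t'"
    have "c * t * \<rho> (\<sigma> s t) \<le> c * t' * \<rho> (\<sigma> s t)"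
      using t c \<rho>_nonneg[OF \<sigma>(1)] that by (intro mult_right_mono) auto
    then have "s \<le> K t' (\<sigma> s t)" using \<sigma>(2)[of t s] t that by (simp add: K_def)
    then show "\<sigma> s t' \<le> \<sigma> s t" using less_\<sigma>[of t' s "\<sigma> s t"] \<sigma>(1)[of t s] t that by auto
  qed
  moreover have "(\<sigma> s \<longlongrightarrow> 0) at_top" if s: "0 \<le> s" for s
  proof (rule order_tendstoI)
    fix a :: real
    have nonneg: "\<forall>\<^sub>F t::real in at_top. 0 \<le> t" by (rule eventually_ge_at_top)
    show "\<forall>\<^sub>F t in at_top. a < \<sigma> s t" if "a < 0"
      using nonneg by eventually_elim (use \<sigma>(1)[OF _ s] that in fastforce)
    show "\<forall>\<^sub>F t in at_top. \<sigma> s t < a" if a: "0 < a"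
    proof -
      have "0 < \<rho> a" using \<rho>_mono \<rho>0 a by (metis atLeast_iff less_eq_real_def strict_mono_onD)
      have "\<forall>\<^sub>F t in at_top. s / (c * \<rho> a) \<le> t" by (rule eventually_ge_at_top)
      with nonneg show ?thesis
      proof eventually_elim
        case (elim t)
        then have "s \<le> c * t * \<rho> a" using c \<open>0 < \<rho> a\<close> by (simp add: field_simps)
        then show ?case using \<sigma>_less[of t s a] elim s a by (simp add: K_def)
      qed
    qed
  qed
  ultimately have "class_KL \<sigma>" using \<sigma>(1) by (simp add: class_KL_def)
  moreover have "v \<le> \<sigma> s t" if "0 \<le> v" "0 \<le> t" "v + c * t * \<rho> v \<le> s" for s t v
  proof -
    have "0 \<le> s" using that c \<rho>_nonneg[of v] by (smt (verit) mult_nonneg_nonneg)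
    then show ?thesis using \<sigma>_less[of t s v] that by (simp add: K_def not_less[symmetric])
  qed
  ultimately show ?thesis by blast
qed

section \<open>Decay above a threshold\<close>

lemma time_interval_initial_segment:
  assumes "t \<in> time_interval T"
  shows "0 \<le> t" "{0..t} \<subseteq> time_interval T"
proof -
  show "0 \<le> t" using assms by (simp add: time_interval_def)
  have "ereal u < T" if "u \<le> t" for u
    using assms that le_less_trans[of "ereal u" "ereal t" T] by (simp add: time_interval_def)
  then show "{0..t} \<subseteq> time_interval T" by (auto simp: time_interval_def)
qed

text \<open>
  A function that is above \<open>\<alpha>\<close> at time \<open>t\<close> has been above \<open>\<alpha>\<close> ever since time \<open>0\<close>, as it cannot
  cross that level upwards. So it was nonincreasing all the time, and its slope never exceeded
  the one allowed at its smallest value \<open>y t\<close>. The rate \<open>\<rho> (y t)\<close> is weakened to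
  \<open>\<rho> (y t - \<alpha>)\<close> to obtain an inequality for \<open>y - \<alpha>\<close> alone.
\<close>
lemma decay_above_threshold:
  fixes y y' :: "real \<Rightarrow> real"
  assumes \<rho>: "class_K_inf \<rho>" and c: "0 \<le> c" and \<alpha>: "0 \<le> \<alpha>" and t: "0 \<le> t"
    and der: "\<And>u. u \<in> {0..t} \<Longrightarrow> (y has_real_derivative y' u) (at u within {0..t})"
    and dissip: "\<And>u. u \<in> {0..t} \<Longrightarrow> \<alpha> < y u \<Longrightarrow> y' u \<le> - c * \<rho> (y u)"
  shows "max (y t - \<alpha>) 0 + c * t * \<rho> (max (y t - \<alpha>) 0) \<le> max (y 0 - \<alpha>) 0"
proof (cases "\<alpha> < y t")
  case False
  then show ?thesis using \<rho> by (simp add: class_K_inf_def max_def)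
next
  case True
  note \<rho>_nonneg = class_K_inf_nonneg[OF \<rho>]
  have cont: "continuous_on {0..t} y"
    using der by (meson DERIV_continuous continuous_on_eq_continuous_within)
  have mvt: "\<exists>\<xi>\<in>{a<..<b}. y b - y a = (b - a) * y' \<xi>" if "0 \<le> a" "a < b" "b \<le> t" for a b
  proof -
    have "(y has_derivative (*) (y' u)) (at u)" if "a < u" "u < b" for u
    proof -
      have "at u within {0..t} = at u"
        using that \<open>0 \<le> a\<close> \<open>b \<le> t\<close> by (intro at_within_interior) auto
      then show ?thesis
        using der[of u] that \<open>0 \<le> a\<close> \<open>b \<le> t\<close> by (simp add: has_field_derivative_def)
    qed
    moreover have "continuous_on {a..b} y"
      using that by (intro continuous_on_subset[OF cont]) auto
    ultimately obtain \<xi> where "a < \<xi>" "\<xi> < b" "y b - y a = y' \<xi> * (b - a)"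
      using mvt[OF \<open>a < b\<close>, of y "\<lambda>u. (*) (y' u)"] by metis
    then show ?thesis by (intro bexI[of _ \<xi>]) (auto simp: mult.commute)
  qed
  have above: "\<alpha> < y u" if u: "u \<in> {0..t}" for u
  proof (rule ccontr)
    assume "\<not> \<alpha> < y u"
    \<comment> \<open>The last time \<open>a\<close> before \<open>t\<close> at level at most \<open>\<alpha>\<close>: from \<open>a\<close> to \<open>t\<close> the function would have to
        grow, although it is above \<open>\<alpha>\<close> in between.\<close>
    define A where "A = {0..t} \<inter> y -` {..\<alpha>}"
    have "closed A"
      unfolding A_def using cont by (intro continuous_closed_preimage) auto
    then have "compact A"
      by (rule compact_eq_bounded_closed[THEN iffD2, OF conjI, rotated]) (simp add: A_def bounded_Int)
    moreover have "A \<noteq> {}" using u \<open>\<not> \<alpha> < y u\<close> by (auto simp: A_def)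
    ultimately obtain a where a: "a \<in> A" "\<And>b. b \<in> A \<Longrightarrow> b \<le> a"
      using compact_attains_sup[of A] by metis
    have "a < t" using a(1) True by (cases "a = t") (auto simp: A_def)
    then obtain \<xi> where \<xi>: "\<xi> \<in> {a<..<t}" "y t - y a = (t - a) * y' \<xi>"
      using mvt[of a t] a(1) by (auto simp: A_def)
    have "\<xi> \<notin> A" using a(2)[of \<xi>] \<xi>(1) by auto
    then have "\<alpha> < y \<xi>" using \<xi>(1) a(1) by (auto simp: A_def)
    moreover from this have "0 \<le> c * \<rho> (y \<xi>)" using c \<rho>_nonneg[of "y \<xi>"] \<alpha> by simp
    ultimately have "y' \<xi> \<le> 0"
      using dissip[of \<xi>] \<xi>(1) a(1) by (simp add: A_def)
    then have "y t \<le> y a" using \<xi>(2) \<open>a < t\<close> by (smt (verit) mult_nonneg_nonpos)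
    then show False using a(1) True by (simp add: A_def)
  qed
  have nonpos: "y' u \<le> 0" if "u \<in> {0..t}" for u
    using dissip[OF that above[OF that]] c \<rho>_nonneg[of "y u"] above[OF that] \<alpha>
    by (smt (verit) mult_minus_left mult_nonneg_nonneg)
  have anti: "y t \<le> y u" if "u \<in> {0..t}" for u
  proof (cases "u = t")
    case False
    then obtain \<xi> where "\<xi> \<in> {u<..<t}" "y t - y u = (t - u) * y' \<xi>"
      using mvt[of u t] \<open>u \<in> {0..t}\<close> by auto
    then show ?thesis using nonpos[of \<xi>] that by (smt (verit) atLeastAtMost_iff greaterThanLessThan_iff mult_nonneg_nonpos)
  qed simp
  have "y t - y 0 \<le> - (c * t * \<rho> (y t - \<alpha>))"
  proof (cases "t = 0")
    case False
    then obtain \<xi> where \<xi>: "\<xi> \<in> {0<..<t}" "y t - y 0 = t * y' \<xi>"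
      using mvt[of 0 t] t by auto
    have "\<rho> (y t - \<alpha>) \<le> \<rho> (y \<xi>)"
      using \<rho> anti[of \<xi>] \<xi>(1) True \<alpha>
      by (intro strict_mono_on_leD[of "{0..}" \<rho>]) (auto simp: class_K_inf_def)
    then have "y' \<xi> \<le> - c * \<rho> (y t - \<alpha>)"
      using dissip[of \<xi>] above[of \<xi>] \<xi>(1) c
      by (smt (verit) atLeastAtMost_iff greaterThanLessThan_iff mult_left_mono mult_minus_left)
    then have "t * y' \<xi> \<le> t * (- c * \<rho> (y t - \<alpha>))" using t by (rule mult_left_mono)
    then show ?thesis using \<xi>(2) by (simp add: algebra_simps)
  qed simp
  then show ?thesis using True above[of 0] t by (simp add: max_def)
qed

section \<open>Locally Lipschitz functions\<close>

lemma locally_lipschitz_continuous_on: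
  assumes "locally_lipschitz f"
  shows "continuous_on S f"
proof -
  have "continuous (at x) f" for x
  proof -
    obtain u L where "0 < u" "L-lipschitz_on (cball x u) f"
      using assms unfolding locally_lipschitz_def by blast
    then have "continuous (at x within cball x u) f"
      by (intro lipschitz_on_continuous_within) auto
    moreover have "at x within cball x u = at x"
      using \<open>0 < u\<close> by (intro at_within_nhd[of _ "ball x u"]) auto
    ultimately show ?thesis by simp
  qed
  then show ?thesis by (simp add: continuous_at_imp_continuous_on)
qed

lemma locally_lipschitz_compose:
  assumes f: "locally_lipschitz f" and g: "locally_lipschitz g"
  shows "locally_lipschitz (\<lambda>x. g (f x))"
  unfolding locally_lipschitz_def
proof
  fix x
  obtain u L where u: "0 < u" and L: "L-lipschitz_on (cball x u) f"
    using f unfolding locally_lipschitz_def by blast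
  obtain v M where v: "0 < v" and M: "M-lipschitz_on (cball (f x) v) g"
    using g unfolding locally_lipschitz_def by blast
  have "0 \<le> L" using L by (rule lipschitz_on_nonneg)
  define w where "w = min u (v / (L + 1))"
  have "0 < w" using u v \<open>0 \<le> L\<close> by (simp add: w_def)
  have "f y \<in> cball (f x) v" if "y \<in> cball x w" for y
  proof -
    have "dist (f x) (f y) \<le> L * dist x y"
      using that by (intro lipschitz_onD[OF L]) (use u in \<open>auto simp: w_def\<close>)
    also have "\<dots> \<le> (L + 1) * (v / (L + 1))"
      using that \<open>0 \<le> L\<close> v by (intro mult_mono) (auto simp: w_def)
    also have "\<dots> = v" using \<open>0 \<le> L\<close> by simp
    finally show ?thesis by simp
  qed
  then have "M-lipschitz_on (f ` cball x w) g"
    by (intro lipschitz_on_subset[OF M]) auto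
  moreover have "L-lipschitz_on (cball x w) f"
    by (rule lipschitz_on_subset[OF L]) (auto simp: w_def)
  ultimately have "(M * L)-lipschitz_on (cball x w) (\<lambda>x. g (f x))"
    by (intro lipschitz_on_compose2)
  with \<open>0 < w\<close> show "\<exists>u>0. \<exists>L. L-lipschitz_on (cball x u) (\<lambda>x. g (f x))" by blast
qed

lemma locally_lipschitz_Pair:
  assumes f: "locally_lipschitz f" and g: "locally_lipschitz g"
  shows "locally_lipschitz (\<lambda>x. (f x, g x))"
  unfolding locally_lipschitz_def
proof
  fix x
  obtain u L where u: "0 < u" and L: "L-lipschitz_on (cball x u) f"
    using f unfolding locally_lipschitz_def by blast
  obtain v M where v: "0 < v" and M: "M-lipschitz_on (cball x v) g"
    using g unfolding locally_lipschitz_def by blast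
  have "(sqrt (L\<^sup>2 + M\<^sup>2))-lipschitz_on (cball x (min u v)) (\<lambda>x. (f x, g x))"
    by (intro lipschitz_on_Pair lipschitz_on_subset[OF L] lipschitz_on_subset[OF M]) auto
  with u v show "\<exists>u>0. \<exists>L. L-lipschitz_on (cball x u) (\<lambda>x. (f x, g x))"
    by (metis min_less_iff_conj)
qed

lemma bounded_linear_imp_locally_lipschitz:
  assumes "bounded_linear f"
  shows "locally_lipschitz f"
  unfolding locally_lipschitz_def
proof
  fix x
  obtain L where "L-lipschitz_on (cball x 1) f"
    using bounded_linear.lipschitz_boundE[OF assms] .
  then show "\<exists>u>0. \<exists>L. L-lipschitz_on (cball x u) f"
    using zero_less_one by blast
qed

lemma locally_lipschitz_const: "locally_lipschitz (\<lambda>x. c)"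
  unfolding locally_lipschitz_def using lipschitz_on_constant zero_less_one by blast

text \<open>
  Products of locally Lipschitz functions are locally Lipschitz because a bilinear map is so on
  the product space, its arguments being bounded near each point.
\<close>
lemma bounded_bilinear_imp_locally_lipschitz:
  assumes "bounded_bilinear h"
  shows "locally_lipschitz (\<lambda>p. h (fst p) (snd p))"
  unfolding locally_lipschitz_def
proof
  interpret bounded_bilinear h by fact
  fix p :: "'a \<times> 'b"
  obtain K where K: "0 \<le> K" "\<And>a b. norm (h a b) \<le> norm a * norm b * K"
    using nonneg_bounded by blast
  define B where "B = norm p + 1"
  have "(2 * B * K)-lipschitz_on (cball p 1) (\<lambda>p. h (fst p) (snd p))"
  proof (rule lipschitz_onI)
    show "0 \<le> 2 * B * K" using K by (simp add: B_def)
    have bd: "norm q \<le> B" if "q \<in> cball p 1" for q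
      using that norm_triangle_sub[of q p] by (simp add: B_def dist_norm norm_minus_commute)
    have fst_le: "norm (fst q) \<le> norm q" and snd_le: "norm (snd q) \<le> norm q" for q :: "'a \<times> 'b"
      using norm_fst_le[of "fst q" "snd q"] norm_snd_le[of "snd q" "fst q"] by simp_all
    fix a b assume ab: "a \<in> cball p 1" "b \<in> cball p 1"
    have "h (fst a) (snd a) - h (fst b) (snd b)
        = h (fst (a - b)) (snd a) + h (fst b) (snd (a - b))"
      by (simp add: diff_left diff_right)
    also have "norm \<dots> \<le> norm (fst (a - b)) * norm (snd a) * K + norm (fst b) * norm (snd (a - b)) * K"
      by (intro norm_triangle_mono K)
    also have "\<dots> \<le> norm (a - b) * B * K + B * norm (a - b) * K"
      using order_trans[OF snd_le bd[OF ab(1)]] order_trans[OF fst_le bd[OF ab(2)]] K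
      by (intro add_mono mult_right_mono mult_mono)
        (auto simp: fst_le snd_le B_def simp del: fst_diff snd_diff)
    finally show "dist (h (fst a) (snd a)) (h (fst b) (snd b)) \<le> 2 * B * K * dist a b"
      by (simp add: dist_norm algebra_simps)
  qed
  then show "\<exists>u>0. \<exists>L. L-lipschitz_on (cball p u) (\<lambda>p. h (fst p) (snd p))"
    using zero_less_one by blast
qed

lemma locally_lipschitz_bounded_bilinear:
  assumes "bounded_bilinear h" "locally_lipschitz f" "locally_lipschitz g"
  shows "locally_lipschitz (\<lambda>x. h (f x) (g x))"
  using locally_lipschitz_compose[OF locally_lipschitz_Pair[OF assms(2,3)]
      bounded_bilinear_imp_locally_lipschitz[OF assms(1)]] by simp

lemma locally_lipschitz_add:
  fixes f g :: "'a::metric_space \<Rightarrow> 'b::real_normed_vector"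
  assumes "locally_lipschitz f" "locally_lipschitz g"
  shows "locally_lipschitz (\<lambda>x. f x + g x)"
  using locally_lipschitz_compose[OF locally_lipschitz_Pair[OF assms]
      bounded_linear_imp_locally_lipschitz[OF
        bounded_linear_add[OF bounded_linear_fst bounded_linear_snd]]] by simp

lemma locally_lipschitz_diff:
  fixes f g :: "'a::metric_space \<Rightarrow> 'b::real_normed_vector"
  assumes "locally_lipschitz f" "locally_lipschitz g"
  shows "locally_lipschitz (\<lambda>x. f x - g x)"
  using locally_lipschitz_compose[OF locally_lipschitz_Pair[OF assms]
      bounded_linear_imp_locally_lipschitz[OF
        bounded_linear_sub[OF bounded_linear_fst bounded_linear_snd]]] by simp

lemmas locally_lipschitz_intros =
  locally_lipschitz_const locally_lipschitz_add locally_lipschitz_diff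
  locally_lipschitz_Pair
  locally_lipschitz_bounded_bilinear[OF bounded_bilinear_mult]
  locally_lipschitz_bounded_bilinear[OF bounded_bilinear_scaleR]
  locally_lipschitz_bounded_bilinear[OF bounded_bilinear_inner]

lemma bounded_vector_derivative_imp_lipschitz_on:
  fixes x :: "real \<Rightarrow> 'a::real_normed_vector"
  assumes S: "convex S"
    and der: "\<And>t. t \<in> S \<Longrightarrow> (x has_vector_derivative x' t) (at t within S)"
    and B: "0 \<le> B" "\<And>t. t \<in> S \<Longrightarrow> norm (x' t) \<le> B"
  shows "B-lipschitz_on S x"
proof (rule bounded_derivative_imp_lipschitz)
  show "(x has_derivative (\<lambda>h. h *\<^sub>R x' t)) (at t within S)" if "t \<in> S" for t
    using der[OF that] by (simp add: has_vector_derivative_def)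
  show "onorm (\<lambda>h. h *\<^sub>R x' t) \<le> B" if "t \<in> S" for t
    using mult_left_mono[OF B(2)[OF that], of "\<bar>_\<bar>"] by (intro onorm_le) (simp add: mult.commute)
qed (use S B in auto)

section \<open>Local existence and continuation of solutions\<close>

text \<open>
  The Picard--Lindelof theorem. To make the integral operator a contraction on a whole Banach
  space of bounded continuous functions on the real line, the vector field is composed with the
  nearest-point projection onto a ball (which keeps it Lipschitz and makes it bounded) and time is
  clamped to \<open>[0, \<epsilon>]\<close>. For small \<open>\<epsilon>\<close> the fixed point does not leave the ball, so that neither
  change affects it.
\<close>
lemma locally_lipschitz_local_solution:
  fixes F :: "'a::euclidean_space \<Rightarrow> 'a"
  assumes F: "locally_lipschitz F"
  obtains \<epsilon> w where "0 < \<epsilon>" "w 0 = x0"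
    "\<And>t. t \<in> {0..\<epsilon>} \<Longrightarrow> (w has_vector_derivative F (w t)) (at t within {0..\<epsilon>})"
proof -
  obtain d L where d: "0 < d" and L: "L-lipschitz_on (cball x0 d) F"
    using F unfolding locally_lipschitz_def by blast
  have "0 \<le> L" using L by (rule lipschitz_on_nonneg)
  have "bounded (F ` cball x0 d)"
    by (intro compact_imp_bounded compact_continuous_image locally_lipschitz_continuous_on F) simp
  then obtain M where M: "0 < M" "\<And>x. x \<in> cball x0 d \<Longrightarrow> norm (F x) \<le> M"
    by (auto simp: bounded_pos)
  define G where "G x = F (closest_point (cball x0 d) x)" for x
  have cp: "closest_point (cball x0 d) x \<in> cball x0 d" for x
    using d by (intro closest_point_in_set) auto
  have G_bound: "norm (G x) \<le> M" for x
    unfolding G_def by (intro M cp)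
  have G_lip: "norm (G x - G y) \<le> L * dist x y" for x y
  proof -
    have "dist (G x) (G y) \<le> L * dist (closest_point (cball x0 d) x) (closest_point (cball x0 d) y)"
      unfolding G_def by (intro lipschitz_onD[OF L] cp)
    also have "\<dots> \<le> L * dist x y"
      using d \<open>0 \<le> L\<close> by (intro mult_left_mono closest_point_lipschitz) auto
    finally show ?thesis by (simp add: dist_norm)
  qed
  have G_cont: "continuous_on S G" for S
  proof -
    have "L-lipschitz_on S G"
      using G_lip \<open>0 \<le> L\<close> by (intro lipschitz_onI) (simp_all add: dist_norm)
    then show ?thesis by (rule lipschitz_on_continuous_on)
  qed
  \<comment> \<open>\<open>\<epsilon> \<le> d / M\<close> keeps the solution in the ball; \<open>\<epsilon> \<le> 1 / (2 * (L + 1))\<close> makes \<open>1 / 2\<close> a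
      contraction constant.\<close>
  define \<epsilon> where "\<epsilon> = min (d / M) (1 / (2 * (L + 1)))"
  have \<epsilon>: "0 < \<epsilon>" using d M \<open>0 \<le> L\<close> by (simp add: \<epsilon>_def)
  have "M * \<epsilon> \<le> M * (d / M)" using M by (intro mult_left_mono) (auto simp: \<epsilon>_def)
  then have \<epsilon>M: "M * \<epsilon> \<le> d" using M by simp
  have "L * \<epsilon> \<le> (L + 1) * (1 / (2 * (L + 1)))"
    using \<open>0 \<le> L\<close> \<epsilon> by (intro mult_mono) (auto simp: \<epsilon>_def)
  also have "\<dots> = 1 / 2" using \<open>0 \<le> L\<close> by (simp add: field_simps)
  finally have \<epsilon>L: "L * \<epsilon> \<le> 1 / 2" .
  define c where "c t = min \<epsilon> (max 0 t)" for t :: real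
  have c: "0 \<le> c t" "c t \<le> \<epsilon>" for t using \<epsilon> by (auto simp: c_def)
  define I where "I x t = x0 + integral {0..t} (\<lambda>s. G (apply_bcontfun x s))" for x and t :: real
  have Gx: "continuous_on S (\<lambda>s. G (apply_bcontfun x s))" for S x
    by (rule continuous_on_compose2[OF G_cont[of UNIV]]) auto
  note Gx_int = integrable_continuous_real[OF Gx]
  define \<Phi> where "\<Phi> x = Bcontfun (\<lambda>t. I x (c t))" for x
  have \<Phi>: "apply_bcontfun (\<Phi> x) t = I x (c t)" for x t
  proof -
    have "continuous_on {0..\<epsilon>} (I x)"
      unfolding I_def by (intro continuous_intros indefinite_integral_continuous_1 Gx_int)
    then have "continuous_on UNIV (\<lambda>t. I x (c t))"
      by (rule continuous_on_compose2) (use c in \<open>auto simp: c_def[abs_def] intro!: continuous_intros\<close>)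
    moreover have "norm (I x (c t)) \<le> norm x0 + M * \<epsilon>" for t
    proof -
      have "norm (integral {0..c t} (\<lambda>s. G (apply_bcontfun x s))) \<le> M * (c t - 0)"
        by (intro integral_bound Gx G_bound c)
      also have "\<dots> \<le> M * \<epsilon>" using M c by (intro mult_left_mono) auto
      finally show ?thesis unfolding I_def by (intro norm_triangle_mono) auto
    qed
    ultimately have "(\<lambda>t. I x (c t)) \<in> bcontfun" by (rule bcontfun_normI)
    then show ?thesis by (simp add: \<Phi>_def Bcontfun_inverse)
  qed
  have "dist (\<Phi> x) (\<Phi> y) \<le> 1 / 2 * dist x y" for x y
  proof (rule dist_bound)
    fix t
    have "apply_bcontfun (\<Phi> x) t - apply_bcontfun (\<Phi> y) t
        = integral {0..c t} (\<lambda>s. G (apply_bcontfun x s) - G (apply_bcontfun y s))"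
      by (simp add: \<Phi> I_def integral_diff Gx_int)
    moreover have "norm \<dots> \<le> (L * dist x y) * (c t - 0)"
      by (intro integral_bound continuous_intros Gx c order_trans[OF G_lip] mult_left_mono
          dist_bounded \<open>0 \<le> L\<close>)
    moreover have "\<dots> \<le> (L * dist x y) * \<epsilon>"
      using c \<open>0 \<le> L\<close> by (intro mult_left_mono) auto
    moreover have "\<dots> \<le> 1 / 2 * dist x y"
      using mult_right_mono[OF \<epsilon>L, of "dist x y"] by (simp add: algebra_simps)
    ultimately show "dist (apply_bcontfun (\<Phi> x) t) (apply_bcontfun (\<Phi> y) t) \<le> 1 / 2 * dist x y"
      by (simp add: dist_norm)
  qed
  then obtain w where w: "\<Phi> w = w"
    using banach_fix_type[of "1/2" \<Phi>] by auto
  have w_eq: "apply_bcontfun w t = I w t" if "t \<in> {0..\<epsilon>}" for t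
    using \<Phi>[of w t] that by (simp add: w c_def)
  have in_ball: "apply_bcontfun w t \<in> cball x0 d" if "t \<in> {0..\<epsilon>}" for t
  proof -
    have "norm (integral {0..t} (\<lambda>s. G (apply_bcontfun w s))) \<le> M * (t - 0)"
      using that by (intro integral_bound Gx G_bound) auto
    also have "\<dots> \<le> M * \<epsilon>" using that M by (intro mult_left_mono) auto
    also note \<epsilon>M
    finally show ?thesis by (simp add: w_eq[OF that] I_def dist_norm)
  qed
  have "(apply_bcontfun w has_vector_derivative F (apply_bcontfun w t)) (at t within {0..\<epsilon>})"
    if t: "t \<in> {0..\<epsilon>}" for t
  proof -
    have "((\<lambda>u. integral {0..u} (\<lambda>s. G (apply_bcontfun w s)))
        has_vector_derivative G (apply_bcontfun w t)) (at t within {0..\<epsilon>})"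
      by (rule integral_has_vector_derivative[OF Gx t])
    then have "(I w has_vector_derivative G (apply_bcontfun w t)) (at t within {0..\<epsilon>})"
      unfolding I_def by (auto intro!: derivative_eq_intros)
    then have "(apply_bcontfun w has_vector_derivative G (apply_bcontfun w t)) (at t within {0..\<epsilon>})"
      using t by (rule has_vector_derivative_transform[rotated 2]) (simp add: w_eq)
    moreover have "G (apply_bcontfun w t) = F (apply_bcontfun w t)"
      using closest_point_self[OF in_ball[OF t]] by (simp add: G_def)
    ultimately show ?thesis by simp
  qed
  moreover have "apply_bcontfun w 0 = x0" using \<epsilon> by (simp add: w_eq I_def)
  ultimately show ?thesis using that \<epsilon> by blast
qed

text \<open>
  A bounded solution on \<open>[0, b)\<close> has bounded speed, hence is Lipschitz and has a limit at \<open>b\<close>; a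
  local solution from that limit is appended. The composite function is differentiable at the
  junction because it is continuous there and satisfies the equation on both sides, so it
  satisfies the integral equation on the whole interval.
\<close>
lemma bounded_solution_not_maximal:
  fixes F :: "'a::euclidean_space \<Rightarrow> 'a"
  assumes F: "locally_lipschitz F" and sol: "is_solution F T z" and T: "T \<noteq> \<infinity>"
    and bdd: "bounded (z ` time_interval T)"
  shows "\<not> is_maximal_solution F T z"
proof -
  obtain b where Tb: "T = ereal b" "0 < b"
    using sol T by (cases T) (auto simp: is_solution_def)
  have dom: "time_interval T = {0..<b}" by (auto simp: Tb time_interval_def)
  have der: "(z has_vector_derivative F (z t)) (at t within {0..<b})" if "t \<in> {0..<b}" for t
    using sol that by (simp add: is_solution_def dom)
  have F_cont: "continuous_on S F" for S by (rule locally_lipschitz_continuous_on[OF F])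
  obtain R where "\<forall>t\<in>{0..<b}. norm (z t) \<le> R"
    using bdd by (auto simp: bounded_iff dom)
  then have R: "z t \<in> cball 0 R" if "t \<in> {0..<b}" for t using that by simp
  have "bounded (F ` cball 0 R)"
    by (intro compact_imp_bounded compact_continuous_image F_cont compact_cball)
  then obtain M where M: "0 < M" "\<And>x. x \<in> cball 0 R \<Longrightarrow> norm (F x) \<le> M"
    by (auto simp: bounded_pos)
  have "M-lipschitz_on {0..<b} z"
    by (rule bounded_vector_derivative_imp_lipschitz_on[OF _ der]) (use M R in auto)
  then obtain z1 where z1: "M-lipschitz_on (closure {0..<b}) z1" "\<And>t. t \<in> {0..<b} \<Longrightarrow> z1 t = z t"
    using lipschitz_extend_closure by metis
  have cl: "closure {0..<b} = {0..b}" using Tb by simp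
  obtain \<epsilon> w where \<epsilon>: "0 < \<epsilon>" and w0: "w 0 = z1 b"
    and w: "\<And>t. t \<in> {0..\<epsilon>} \<Longrightarrow> (w has_vector_derivative F (w t)) (at t within {0..\<epsilon>})"
    using locally_lipschitz_local_solution[OF F] by metis
  define Z where "Z t = (if t \<le> b then z1 t else w (t - b))" for t
  have Z_cont: "continuous_on {0..b + \<epsilon>} Z"
  proof -
    have 1: "continuous_on {0..b} z1"
      using lipschitz_on_continuous_on[OF z1(1)] by (simp add: cl)
    have "continuous_on {0..\<epsilon>} w"
      using w by (meson continuous_on_eq_continuous_within has_vector_derivative_continuous)
    then have 2: "continuous_on {b..b + \<epsilon>} (\<lambda>t. w (t - b))"
      by (rule continuous_on_compose2) (auto intro!: continuous_intros)
    have "continuous_on ({0..b} \<union> {b..b + \<epsilon>}) Z"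
      unfolding Z_def
      by (rule continuous_on_If) (use 1 2 w0 in auto)
    moreover have "{0..b} \<union> {b..b + \<epsilon>} = {0..b + \<epsilon>}" using Tb \<epsilon> by auto
    ultimately show ?thesis by simp
  qed
  have Z_der: "(Z has_vector_derivative F (Z t)) (at t)" if t: "t \<in> {0<..<b + \<epsilon>} - {b}" for t
  proof (cases "t < b")
    case True
    have "at t within {0..<b} = at t"
      using True t by (intro at_within_nhd[of _ "{0<..<b}"]) auto
    then have "(z has_vector_derivative F (z t)) (at t)"
      using der[of t] True t by simp
    then have "(Z has_vector_derivative F (z t)) (at t)"
      by (rule has_vector_derivative_transform_within_open[of _ _ _ "{0<..<b}"])
        (use True t in \<open>auto simp: Z_def z1\<close>)
    then show ?thesis using True t by (simp add: Z_def z1)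
  next
    case False
    then have tb: "b < t" using t by auto
    have "at (t - b) within {0..\<epsilon>} = at (t - b)"
      using tb t by (intro at_within_nhd[of _ "{0<..<\<epsilon>}"]) auto
    then have "(w has_vector_derivative F (w (t - b))) (at (t - b))"
      using w[of "t - b"] tb t by simp
    moreover have "((\<lambda>t. t - b) has_vector_derivative 1) (at t)"
      by (auto intro!: derivative_eq_intros)
    ultimately have "((\<lambda>t. w (t - b)) has_vector_derivative F (w (t - b))) (at t)"
      using vector_diff_chain_at[of "\<lambda>t. t - b" 1 t w "F (w (t - b))"] by (simp add: o_def)
    then have "(Z has_vector_derivative F (w (t - b))) (at t)"
      by (rule has_vector_derivative_transform_within_open[of _ _ _ "{b<..}"])
        (use tb in \<open>auto simp: Z_def\<close>)
    then show ?thesis using tb by (simp add: Z_def)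
  qed
  have FZ_cont: "continuous_on {0..b + \<epsilon>} (\<lambda>s. F (Z s))"
    by (rule continuous_on_compose2[OF F_cont[of UNIV] Z_cont]) auto
  have Z_int: "Z t = Z 0 + integral {0..t} (\<lambda>s. F (Z s))" if "t \<in> {0..b + \<epsilon>}" for t
  proof -
    have "((\<lambda>s. F (Z s)) has_integral (Z t - Z 0)) {0..t}"
      by (rule fundamental_theorem_of_calculus_interior_strong[of "{b}"])
        (use that Z_der in \<open>auto intro: continuous_on_subset[OF Z_cont]\<close>)
    then show ?thesis by (simp add: integral_unique)
  qed
  have Z_der': "(Z has_vector_derivative F (Z t)) (at t within {0..b + \<epsilon>})"
    if t: "t \<in> {0..b + \<epsilon>}" for t
  proof -
    have "((\<lambda>t. Z 0 + integral {0..t} (\<lambda>s. F (Z s))) has_vector_derivative F (Z t))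
        (at t within {0..b + \<epsilon>})"
      using integral_has_vector_derivative[OF FZ_cont t] by (auto intro!: derivative_eq_intros)
    then show ?thesis
      using t by (rule has_vector_derivative_transform[rotated 2]) (rule Z_int)
  qed
  have dom': "time_interval (ereal (b + \<epsilon>)) \<subseteq> {0..b + \<epsilon>}" by (auto simp: time_interval_def)
  have "is_solution F (ereal (b + \<epsilon>)) Z"
    unfolding is_solution_def
  proof (intro conjI ballI)
    show "0 < ereal (b + \<epsilon>)" using Tb \<epsilon> by simp
    show "(Z has_vector_derivative F (Z t)) (at t within time_interval (ereal (b + \<epsilon>)))"
      if "t \<in> time_interval (ereal (b + \<epsilon>))" for t
      using has_vector_derivative_within_subset[OF Z_der' dom'] that dom' by blast
  qed
  moreover have "\<forall>t\<in>time_interval T. Z t = z t" by (auto simp: dom Z_def z1)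
  moreover have "T < ereal (b + \<epsilon>)" using \<epsilon> by (simp add: Tb)
  ultimately show ?thesis unfolding is_maximal_solution_def by blast
qed

section \<open>Gradients\<close>

text \<open>
  The gradient is defined by a unique description; existence is the Riesz representation of the
  derivative, obtained from its adjoint.
\<close>
lemma differentiable_imp_GDERIV_gradient:
  fixes P :: "'a::euclidean_space \<Rightarrow> real"
  assumes "P differentiable (at x)"
  shows "GDERIV P x :> gradient P x"
proof -
  obtain D where D: "(P has_derivative D) (at x)" using assms by (auto simp: differentiable_def)
  have "D = (\<lambda>h. h \<bullet> adjoint D 1)"
    using adjoint_works[OF has_derivative_linear[OF D], of _ 1] by (intro ext) simp
  then have G: "GDERIV P x :> adjoint D 1"
    using D by (simp add: gderiv_def)
  moreover have "E = E'" if "GDERIV P x :> E" "GDERIV P x :> E'" for E E'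
  proof -
    have "(\<lambda>h. h \<bullet> E) = (\<lambda>h. h \<bullet> E')"
      using that unfolding gderiv_def by (rule has_derivative_unique)
    then show ?thesis by (metis inner_commute vector_eq_ldot)
  qed
  ultimately show ?thesis unfolding gradient_def by (metis (no_types, lifting) theI)
qed

lemma C2_fun_locally_lipschitz_gradient:
  fixes P :: "real ^ 'n \<Rightarrow> real"
  assumes "C2_fun P"
  shows "locally_lipschitz (gradient P)"
  unfolding locally_lipschitz_def
proof
  fix x
  obtain H where H: "\<And>x. (gradient P has_derivative (\<lambda>v. H x *v v)) (at x)"
    and H_cont: "continuous_on UNIV H"
    using assms unfolding C2_fun_def by blast
  have "compact (H ` cball x 1)"
    by (intro compact_continuous_image continuous_on_subset[OF H_cont]) auto
  then obtain B where B: "0 < B" "\<And>y. y \<in> cball x 1 \<Longrightarrow> norm (H y) \<le> B"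
    by (auto dest!: compact_imp_bounded simp: bounded_pos)
  let ?C = "real CARD('n) * real CARD('n) * B"
  have "\<bar>H y $ i $ j\<bar> \<le> B" if "y \<in> cball x 1" for y i j
    using component_le_norm_cart[of "H y $ i" j] Finite_Cartesian_Product.norm_nth_le[of "H y" i]
      B(2)[OF that] by linarith
  then have "?C-lipschitz_on (cball x 1) (gradient P)"
    using B by (intro bounded_derivative_imp_lipschitz[where f' = "\<lambda>y. (*v) (H y)"]
        has_derivative_at_withinI[OF H] onorm_le_matrix_component convex_cball) auto
  then show "\<exists>u>0. \<exists>L. L-lipschitz_on (cball x u) (gradient P)"
    using zero_less_one by blast
qed

lemma has_real_derivative_compose_gradient:
  fixes P :: "'a::euclidean_space \<Rightarrow> real"
  assumes "P differentiable (at (x t))" "(x has_vector_derivative v) (at t within S)"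
  shows "((\<lambda>t. P (x t)) has_real_derivative (gradient P (x t) \<bullet> v)) (at t within S)"
proof -
  have "(P has_derivative (\<lambda>h. h \<bullet> gradient P (x t))) (at (x t))"
    using differentiable_imp_GDERIV_gradient[OF assms(1)] by (simp add: gderiv_def)
  from has_derivative_compose[OF assms(2)[unfolded has_vector_derivative_def] this]
  show ?thesis
    by (simp add: has_field_derivative_def inner_commute mult.commute[of _ "_ \<bullet> _"] mult_commute_abs)
qed

section \<open>The closed loop\<close>

lemma young_inequality_weighted:
  fixes x y \<epsilon> :: real
  assumes "0 < \<epsilon>"
  shows "x * y \<le> \<epsilon> * x\<^sup>2 + y\<^sup>2 / (4 * \<epsilon>)"
proof -
  have "0 \<le> (2 * \<epsilon> * x - y)\<^sup>2 / (4 * \<epsilon>)" using assms by simp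
  also have "\<dots> = \<epsilon> * x\<^sup>2 - x * y + y\<^sup>2 / (4 * \<epsilon>)"
    using assms by (simp add: field_simps power2_eq_square)
  finally show ?thesis by simp
qed

text \<open>
  The three damping terms match three uses of Young's inequality. Since
  \<open>|b|\<^sup>2 \<le> m q\<close>, a term \<open>a |b| |w|\<close> costs at most \<open>m a\<^sup>2 w\<^sup>2 + q/4\<close>, which is used for
  \<open>a = |\<eta>|\<close> and for \<open>a = sqrt r\<close>. With \<open>s = (|\<theta>|\<^sup>2 - r)\<^sup>+\<close>, splitting
  \<open>|\<theta>| \<le> sqrt r + sqrt s\<close> leaves \<open>sqrt s |b| |w|\<close>, which the damping with gain \<open>\<delta>/2\<close>
  absorbs at the cost of \<open>s/(2\<delta>)\<close>. This splitting is why only the excess of \<open>|\<theta>|\<^sup>2\<close> over \<open>r\<close>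
  enters the bound.
\<close>
lemma dissipation_inequality:
  fixes b \<theta> \<eta> :: "'a::real_inner" and w q m \<delta> r :: real
  assumes m: "0 < m" and b: "(norm b)\<^sup>2 \<le> m * q" and \<delta>: "0 < \<delta>" and r: "0 \<le> r"
  shows "w * (b \<bullet> \<theta>) - w * (b \<bullet> \<eta>) - (\<delta> / 2 * (norm b)\<^sup>2 + m * (r + (norm \<eta>)\<^sup>2)) * w\<^sup>2
    \<le> q / 2 + max ((norm \<theta>)\<^sup>2 - r) 0 / (2 * \<delta>)"
proof -
  define s where "s = max ((norm \<theta>)\<^sup>2 - r) 0"
  have s: "0 \<le> s" by (simp add: s_def)
  have bq: "(norm b)\<^sup>2 / (4 * m) \<le> q / 4" using m b by (simp add: field_simps)
  have absorb: "norm b * a * \<bar>w\<bar> \<le> m * a\<^sup>2 * w\<^sup>2 + q / 4" for a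
    using young_inequality_weighted[OF m, of "a * \<bar>w\<bar>" "norm b"] bq
    by (simp add: power_mult_distrib mult_ac)
  have cs: "w * (b \<bullet> v) \<le> norm b * norm v * \<bar>w\<bar>" for v
    using mult_left_mono[OF Cauchy_Schwarz_ineq2[of b v], of "\<bar>w\<bar>"]
    by (metis abs_ge_self abs_ge_zero abs_mult mult.commute order_trans)
  have "norm \<theta> \<le> sqrt (r + s)" by (rule real_le_rsqrt) (simp add: s_def)
  also have "\<dots> \<le> sqrt r + sqrt s" using r s by (rule sqrt_add_le_add_sqrt)
  finally have "norm b * norm \<theta> * \<bar>w\<bar> \<le> norm b * (sqrt r + sqrt s) * \<bar>w\<bar>"
    by (intro mult_right_mono mult_left_mono) auto
  also have "\<dots> = norm b * sqrt r * \<bar>w\<bar> + norm b * \<bar>w\<bar> * sqrt s" by (simp add: algebra_simps)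
  also have "\<dots> \<le> (m * r * w\<^sup>2 + q / 4) + (\<delta> / 2 * (norm b)\<^sup>2 * w\<^sup>2 + s / (2 * \<delta>))"
    using absorb[of "sqrt r"] young_inequality_weighted[of "\<delta> / 2" "norm b * \<bar>w\<bar>" "sqrt s"] r s \<delta>
    by (simp add: power_mult_distrib mult_ac)
  finally have "w * (b \<bullet> \<theta>) \<le> m * r * w\<^sup>2 + q / 4 + \<delta> / 2 * (norm b)\<^sup>2 * w\<^sup>2 + s / (2 * \<delta>)"
    using cs[of \<theta>] by linarith
  moreover have "- (w * (b \<bullet> \<eta>)) \<le> m * (norm \<eta>)\<^sup>2 * w\<^sup>2 + q / 4"
    using cs[of "- \<eta>"] absorb[of "norm \<eta>"] by simp
  ultimately show ?thesis by (simp add: algebra_simps flip: s_def)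
qed

lemma closed_loop_locally_lipschitz:
  fixes f g :: "real ^ 'n \<Rightarrow> real ^ 'n" and \<phi> :: "real ^ 'n \<Rightarrow> real ^ 'p"
  assumes "locally_lipschitz f" "locally_lipschitz g" "locally_lipschitz \<phi>"
    and "C2_fun P" "locally_lipschitz k" "locally_lipschitz \<mu>"
  shows "locally_lipschitz (closed_loop f g \<phi> \<theta> P k \<mu> \<Gamma> \<delta> r)"
proof -
  have fst: "locally_lipschitz (fst :: (real ^ 'n) \<times> (real ^ 'p) \<Rightarrow> _)"
    and snd: "locally_lipschitz (snd :: (real ^ 'n) \<times> (real ^ 'p) \<Rightarrow> _)"
    by (intro bounded_linear_imp_locally_lipschitz bounded_linear_fst bounded_linear_snd)+
  have mat: "locally_lipschitz ((*v) \<Gamma>)"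
    by (intro bounded_linear_imp_locally_lipschitz matrix_vector_mul_bounded_linear)
  note lifts = assms(1-3,5,6)[THEN locally_lipschitz_compose[OF fst]]
    locally_lipschitz_compose[OF fst C2_fun_locally_lipschitz_gradient[OF assms(4)]]
  show ?thesis
    unfolding closed_loop_def plant_def control_law_def update_law_def case_prod_beta
      power2_norm_eq_inner
    by (intro locally_lipschitz_intros lifts fst snd locally_lipschitz_compose[OF _ mat])
qed

lemma bounded_sublevel_of_radially_unbounded:
  assumes "radially_unbounded P"
  shows "bounded {x. P x \<le> c}"
proof -
  have "\<forall>\<^sub>F x in at_infinity. c < P x"
    using assms by (simp add: radially_unbounded_def filterlim_at_top_dense)
  then obtain R where "\<And>x. R \<le> norm x \<Longrightarrow> c < P x" by (auto simp: eventually_at_infinity)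
  then show ?thesis by (intro boundedI[of _ R]) (metis linorder_le_cases mem_Collect_eq not_less)
qed

lemma is_solution_fst_snd:
  assumes "is_solution F T z" "t \<in> time_interval T"
  shows "((\<lambda>t. fst (z t)) has_vector_derivative fst (F (z t))) (at t within time_interval T)"
    and "((\<lambda>t. snd (z t)) has_vector_derivative snd (F (z t))) (at t within time_interval T)"
  using assms
  by (auto simp: is_solution_def intro: bounded_linear.has_vector_derivative[OF bounded_linear_fst]
      bounded_linear.has_vector_derivative[OF bounded_linear_snd])

lemma bounded_if_bounded_derivative_on_time_interval:
  fixes x :: "real \<Rightarrow> 'a::real_normed_vector"
  assumes der: "\<And>t. t \<in> time_interval T \<Longrightarrow> (x has_vector_derivative x' t) (at t within time_interval T)"
    and bdd: "bounded (x' ` time_interval T)" and T: "T \<noteq> \<infinity>"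
  shows "bounded (x ` time_interval T)"
proof (cases "0 < T")
  case False
  then have "time_interval T = {}"
    by (auto simp: time_interval_def zero_ereal_def[symmetric] not_less)
      (metis ereal_less_eq(5) leD order.strict_trans1 order_trans)
  then show ?thesis by simp
next
  case True
  then obtain b where Tb: "T = ereal b" "0 < b" using T by (cases T) auto
  have dom: "time_interval T = {0..<b}" by (auto simp: Tb time_interval_def)
  obtain B where B: "0 < B" "\<And>t. t \<in> {0..<b} \<Longrightarrow> norm (x' t) \<le> B"
    using bdd by (auto simp: bounded_pos dom)
  have lip: "B-lipschitz_on {0..<b} x"
    by (rule bounded_vector_derivative_imp_lipschitz_on[of _ _ x']) (use der B in \<open>auto simp: dom\<close>)
  have "norm (x t - x 0) \<le> B * b" if "t \<in> {0..<b}" for t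
  proof -
    have "norm (x t - x 0) \<le> B * norm (t - 0)"
      using that by (intro lipschitz_on_normD[OF lip]) auto
    also have "\<dots> \<le> B * b" using that B(1) by (intro mult_left_mono) auto
    finally show ?thesis .
  qed
  then have "norm (x t) \<le> norm (x 0) + B * b" if "t \<in> {0..<b}" for t
    using norm_triangle_sub[of "x t" "x 0"] that by fastforce
  then show ?thesis unfolding dom by (intro boundedI[of _ "norm (x 0) + B * b"]) auto
qed

theorem theorem1:
  fixes f g :: "real ^ 'n \<Rightarrow> real ^ 'n"
    and \<phi> :: "real ^ 'n \<Rightarrow> real ^ 'p"
    and \<theta> :: "real ^ 'p"
    and P Q k \<mu> :: "real ^ 'n \<Rightarrow> real"
    and \<Gamma> :: "real ^ 'p ^ 'p"
    and \<delta> r :: real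
    and \<rho> :: "real \<Rightarrow> real"
  assumes "locally_lipschitz f" and "locally_lipschitz g" and "locally_lipschitz \<phi>"
    and "f 0 = 0" and "\<phi> 0 = 0"
    and "C2_fun P" and "positive_definite_fun P" and "radially_unbounded P"
    and "continuous_on UNIV Q" and "positive_definite_fun Q" and "radially_unbounded Q"
    and "locally_lipschitz k" and "k 0 = 0"
    and "\<forall>x. gradient P x \<bullet> f x + (gradient P x \<bullet> g x) * k x \<le> - Q x"
    and "locally_lipschitz \<mu>" and "\<forall>x. \<mu> x > 0"
    and "\<forall>x. (norm (\<phi> x))\<^sup>2 \<le> \<mu> x * Q x"
    and "positive_definite_matrix \<Gamma>"
    and "\<delta> > 0" and "r \<ge> 0"
    and "class_K_inf \<rho>" and "\<forall>x. \<rho> (P x) \<le> Q x"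
  shows "\<forall>lam\<in>{0<..<1}.
    let \<alpha> = inverse_on_nonneg \<rho> (inverse (1 - lam) * inverse \<delta> * max ((norm \<theta>)\<^sup>2 - r) 0)
    in \<exists>\<sigma>. class_KL \<sigma> \<and>
      (\<forall>T z. is_solution (closed_loop f g \<phi> \<theta> P k \<mu> \<Gamma> \<delta> r) T z \<longrightarrow>
        (is_maximal_solution (closed_loop f g \<phi> \<theta> P k \<mu> \<Gamma> \<delta> r) T z \<longrightarrow> T = \<infinity>) \<and>
        (\<forall>t\<in>time_interval T.
          max (P (fst (z t)) - \<alpha>) 0 \<le> \<sigma> (max (P (fst (z 0)) - \<alpha>) 0) t))"
proof (intro ballI)
  fix lam :: real assume lam: "lam \<in> {0<..<1}"
  let ?F = "closed_loop f g \<phi> \<theta> P k \<mu> \<Gamma> \<delta> r"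
  define e where "e = max ((norm \<theta>)\<^sup>2 - r) 0"
  define \<alpha> where "\<alpha> = inverse_on_nonneg \<rho> (inverse (1 - lam) * inverse \<delta> * e)"
  have "0 \<le> inverse (1 - lam) * inverse \<delta> * e" using lam \<open>\<delta> > 0\<close> by (simp add: e_def)
  note mem = class_K_inf_surj[OF \<open>class_K_inf \<rho>\<close> this]
  have \<alpha>: "0 \<le> \<alpha>" and \<rho>\<alpha>: "\<rho> \<alpha> = inverse (1 - lam) * inverse \<delta> * e"
    unfolding \<alpha>_def inverse_on_nonneg_def using inv_into_into[OF mem] f_inv_into_f[OF mem] by simp_all
  have P_diff: "P differentiable (at x)" for x using \<open>C2_fun P\<close> by (simp add: C2_fun_def)
  have grad_cont: "continuous_on UNIV (gradient P)"
    by (intro locally_lipschitz_continuous_on C2_fun_locally_lipschitz_gradient assms)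
  \<comment> \<open>Above \<open>\<alpha>\<close>, the fraction \<open>1 - lam\<close> of the decay \<open>- \<rho> (P x) / 2\<close> pays for the unmatched part of
      \<open>\<theta>\<close>; the fraction \<open>lam\<close> remains.\<close>
  have dissip: "gradient P x \<bullet> fst (?F (x, \<eta>)) \<le> - (lam / 2) * \<rho> (P x)" if "\<alpha> < P x" for x \<eta>
  proof -
    define w where "w = gradient P x \<bullet> g x"
    have "gradient P x \<bullet> fst (?F (x, \<eta>))
        = (gradient P x \<bullet> f x + w * k x)
          + (w * (\<phi> x \<bullet> \<theta>) - w * (\<phi> x \<bullet> \<eta>)
             - (\<delta> / 2 * (norm (\<phi> x))\<^sup>2 + \<mu> x * (r + (norm \<eta>)\<^sup>2)) * w\<^sup>2)"
      by (simp add: closed_loop_def plant_def control_law_def w_def[symmetric] inner_add_right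
          algebra_simps power2_eq_square)
    also have "\<dots> \<le> - Q x + (Q x / 2 + e / (2 * \<delta>))"
      unfolding e_def w_def
      by (intro add_mono dissipation_inequality) (use assms in auto)
    also have "\<dots> = - (Q x / 2) + e / (2 * \<delta>)" by simp
    also have "\<dots> \<le> - (\<rho> (P x) / 2) + (1 - lam) * \<rho> \<alpha> / 2"
    proof (rule add_mono)
      show "- (Q x / 2) \<le> - (\<rho> (P x) / 2)" using \<open>\<forall>x. \<rho> (P x) \<le> Q x\<close> by simp
      have "(1 - lam) * \<rho> \<alpha> = e / \<delta>" using lam by (simp add: \<rho>\<alpha> divide_inverse)
      then show "e / (2 * \<delta>) \<le> (1 - lam) * \<rho> \<alpha> / 2" by simp
    qed
    also have "\<dots> \<le> - (\<rho> (P x) / 2) + (1 - lam) * \<rho> (P x) / 2"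
    proof -
      have "\<rho> \<alpha> \<le> \<rho> (P x)"
        using \<open>class_K_inf \<rho>\<close> \<alpha> that
        by (intro strict_mono_on_leD[of "{0..}" \<rho>]) (auto simp: class_K_inf_def)
      then show ?thesis using lam by (intro add_left_mono divide_right_mono mult_left_mono) auto
    qed
    also have "\<dots> = - (lam / 2) * \<rho> (P x)" by (simp add: field_simps)
    finally show ?thesis .
  qed
  obtain \<sigma> where KL: "class_KL \<sigma>"
    and \<sigma>: "\<And>s t v. 0 \<le> v \<Longrightarrow> 0 \<le> t \<Longrightarrow> v + lam / 2 * t * \<rho> v \<le> s \<Longrightarrow> v \<le> \<sigma> s t"
    using ex_class_KL_dominating[OF \<open>class_K_inf \<rho>\<close>, of "lam / 2"] lam by auto
  have "(is_maximal_solution ?F T z \<longrightarrow> T = \<infinity>) \<and>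
      (\<forall>t\<in>time_interval T. max (P (fst (z t)) - \<alpha>) 0 \<le> \<sigma> (max (P (fst (z 0)) - \<alpha>) 0) t)"
    if sol: "is_solution ?F T z" for T z
  proof
    let ?v = "\<lambda>t. max (P (fst (z t)) - \<alpha>) 0"
    have decay: "?v t + lam / 2 * t * \<rho> (?v t) \<le> ?v 0" if t: "t \<in> time_interval T" for t
    proof (rule decay_above_threshold)
      note sub = time_interval_initial_segment[OF t]
      show "0 \<le> t" by (rule sub)
      fix u assume u: "u \<in> {0..t}"
      show "((\<lambda>t. P (fst (z t))) has_real_derivative (gradient P (fst (z u)) \<bullet> fst (?F (z u))))
          (at u within {0..t})"
        using u sub(2)
        by (intro has_real_derivative_compose_gradient P_diff
            has_vector_derivative_within_subset[OF is_solution_fst_snd(1)[OF sol]]) auto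
      show "gradient P (fst (z u)) \<bullet> fst (?F (z u)) \<le> - (lam / 2) * \<rho> (P (fst (z u)))"
        if "\<alpha> < P (fst (z u))"
        using dissip[OF that, of "snd (z u)"] by simp
    qed (use lam \<alpha> \<open>class_K_inf \<rho>\<close> in auto)
    show "\<forall>t\<in>time_interval T. ?v t \<le> \<sigma> (?v 0) t"
      by (intro ballI \<sigma> decay) (auto dest: time_interval_initial_segment(1))
    show "is_maximal_solution ?F T z \<longrightarrow> T = \<infinity>"
    proof (intro impI, rule ccontr)
      assume max: "is_maximal_solution ?F T z" and T: "T \<noteq> \<infinity>"
      \<comment> \<open>\<open>P\<close> may increase while it is below \<open>\<alpha>\<close>, hence the bound \<open>\<alpha> + ?v 0\<close> and not \<open>P (fst (z 0))\<close>.\<close>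
      define C where "C = {x. P x \<le> \<alpha> + ?v 0}"
      have "fst (z t) \<in> C" if t: "t \<in> time_interval T" for t
      proof -
        have "0 \<le> lam / 2 * t * \<rho> (?v t)"
          using lam class_K_inf_nonneg[OF \<open>class_K_inf \<rho>\<close>, of "?v t"]
            time_interval_initial_segment(1)[OF t] by simp
        then show ?thesis using decay[OF t] by (simp add: C_def)
      qed
      then have x_in: "(\<lambda>t. fst (z t)) ` time_interval T \<subseteq> C" by auto
      have C_bdd: "bounded C"
        unfolding C_def using assms(8) by (rule bounded_sublevel_of_radially_unbounded)
      then have x_bdd: "bounded ((\<lambda>t. fst (z t)) ` time_interval T)"
        using x_in by (rule bounded_subset)
      \<comment> \<open>The speed of the parameter estimate is a continuous function of the plant state alone.\<close>
      have "continuous_on UNIV (update_law g \<phi> P \<Gamma>)"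
        unfolding update_law_def
        by (intro continuous_intros grad_cont locally_lipschitz_continuous_on assms
            linear_continuous_on_compose[OF _ matrix_vector_mul_linear])
      then have "compact (update_law g \<phi> P \<Gamma> ` closure C)"
        using C_bdd by (intro compact_continuous_image) (auto intro: continuous_on_subset)
      then have "bounded (update_law g \<phi> P \<Gamma> ` C)"
        by (rule bounded_subset[OF compact_imp_bounded]) (simp add: closure_subset image_mono)
      moreover have "(\<lambda>t. snd (?F (z t))) ` time_interval T \<subseteq> update_law g \<phi> P \<Gamma> ` C"
        using x_in by (auto simp: closed_loop_def case_prod_beta)
      ultimately have "bounded ((\<lambda>t. snd (?F (z t))) ` time_interval T)" by (rule bounded_subset)
      then have "bounded ((\<lambda>t. snd (z t)) ` time_interval T)"
        by (intro bounded_if_bounded_derivative_on_time_interval[OF is_solution_fst_snd(2)[OF sol]] T)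
      then have "bounded ((\<lambda>t. fst (z t)) ` time_interval T \<times> (\<lambda>t. snd (z t)) ` time_interval T)"
        using x_bdd by (rule bounded_Times[rotated])
      then have "bounded (z ` time_interval T)"
        by (rule bounded_subset) (simp add: image_subset_iff mem_Times_iff)
      then have "\<not> is_maximal_solution ?F T z"
        by (intro bounded_solution_not_maximal closed_loop_locally_lipschitz assms sol T)
      then show False using max by contradiction
    qed
  qed
  with KL show "let \<alpha> = inverse_on_nonneg \<rho> (inverse (1 - lam) * inverse \<delta> * max ((norm \<theta>)\<^sup>2 - r) 0)
    in \<exists>\<sigma>. class_KL \<sigma> \<and>
      (\<forall>T z. is_solution ?F T z \<longrightarrow> (is_maximal_solution ?F T z \<longrightarrow> T = \<infinity>) \<and>
        (\<forall>t\<in>time_interval T. max (P (fst (z t)) - \<alpha>) 0 \<le> \<sigma> (max (P (fst (z 0)) - \<alpha>) 0) t))"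
    unfolding Let_def e_def[symmetric] \<alpha>_def[symmetric] by blast
qed

end
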